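(* Let $R$ be a noetherian (i.e. left and right noetherian) ring. Then $R$ is a principal right ideal ring if and only if every maximal right ideal of $R$ is principal.
   Context: Rings are associative with identity, not necessarily commutative. A principal right ideal ring is a ring in which every right ideal is principal, i.e. of the form $xR$. *)

theory Defs
  imports "HOL-Algebra.Ideal"
begin

locale right_ideal = additive_subgroup I R + ring R for I and R (structure) +
  assumes I_r_closed: "\<lbrakk>a \<in> I; x \<in> carrier R\<rbrakk> \<Longrightarrow> a \<otimes> x \<in> I"

locale left_ideal = additive_subgroup I R + ring R for I and R (structure) +
  assumes I_l_closed: "\<lbrakk>a \<in> I; x \<in> carrier R\<rbrakk> \<Longrightarrow> x \<otimes> a \<in> I"

(* The whole ring is not counted as maximal, as in the library's maximalideal. *)
locale maximal_right_ideal = right_ideal +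
  assumes I_notcarr: "carrier R \<noteq> I"
    and I_maximal: "\<lbrakk>right_ideal J R; I \<subseteq> J; J \<subseteq> carrier R\<rbrakk> \<Longrightarrow> J = I \<or> J = carrier R"

(* The library's cgenideal x is the set Rx; here the multiples xR are needed. *)
locale principal_right_ideal = right_ideal +
  assumes generate: "\<exists>x \<in> carrier R. I = {x \<otimes> r | r. r \<in> carrier R}"

locale principal_right_ideal_ring = ring +
  assumes right_ideal_principal: "right_ideal I R \<Longrightarrow> principal_right_ideal I R"

(* The library's noetherian_ring only restricts two-sided ideals, which is too weak for
   noncommutative rings; hence the chain conditions on one-sided ideals. *)
locale right_noetherian_ring = ring +
  assumes right_acc: "\<lbrakk>\<And>n::nat. right_ideal (C n) R; \<And>n. C n \<subseteq> C (Suc n)\<rbrakk>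
    \<Longrightarrow> \<exists>N. \<forall>n\<ge>N. C n = C N"

locale left_noetherian_ring = ring +
  assumes left_acc: "\<lbrakk>\<And>n::nat. left_ideal (C n) R; \<And>n. C n \<subseteq> C (Suc n)\<rbrakk>
    \<Longrightarrow> \<exists>N. \<forall>n\<ge>N. C n = C N"

end

theory Submission
  imports Defs "HOL-Algebra.Multiplicative_Group"
begin

text \<open>Suppose every maximal right ideal is principal. If \<open>J\<close> is a right ideal with \<open>R/J\<close> artinian, a
  minimal principal right ideal containing \<open>J\<close> equals \<open>J\<close>. Since every right ideal \<open>I\<close> is a direct
  summand of an essential one, it suffices that \<open>R/J\<close> is artinian for all essential \<open>J\<close>.

  Otherwise choose \<open>J\<close> maximal among the essential counterexamples (``critical''), and a maximal right
  ideal \<open>xR\<close> containing it. Then left multiplication by \<open>x\<close> is injective and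
  \<open>J' = {r. xr \<in> J}\<close> is again critical. If a finite family \<open>c\<close> generates \<open>J = xJ'\<close>, then \<open>c = xc'\<close> for
  generators \<open>c'\<close> of \<open>J'\<close>, so \<open>Rc \<subseteq> Rc'\<close> as left submodules of a finite power of \<open>R\<close>. Left noetherianity lets one
  choose \<open>c\<close> with \<open>Rc\<close> maximal, whence \<open>c' = rc = rxc'\<close>. So \<open>1 - rx\<close> annihilates the essential right
  ideal \<open>J'\<close> and is nilpotent, which makes \<open>x\<close> a unit: a contradiction.\<close>

section \<open>Extremal elements from stabilizing chains\<close>

lemma stable_chains_extremal:
  assumes "S \<noteq> {}"
    and stable: "\<And>C :: nat \<Rightarrow> 'b. \<lbrakk>\<And>n. C n \<in> S; \<And>n. prec (C n) (C (Suc n))\<rbrakk> \<Longrightarrow> \<exists>N. \<forall>n\<ge>N. C n = C N"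
  shows "\<exists>m\<in>S. \<forall>s\<in>S. prec m s \<longrightarrow> s = m"
proof (rule ccontr)
  assume "\<not> ?thesis"
  then have step: "\<exists>s. s \<in> S \<and> prec m s \<and> s \<noteq> m" if "m \<in> S" for m
    using that by blast
  \<comment> \<open>Dependent choice turns the failure of the claim into a \<open>prec\<close>-chain
    whose consecutive terms differ, so it never stabilizes. Leaving \<open>prec\<close> open covers
    inclusion and reverse inclusion alike.\<close>
  have "\<exists>C. \<forall>n::nat. C n \<in> S \<and> (prec (C n) (C (Suc n)) \<and> C (Suc n) \<noteq> C n)"
  proof (rule dependent_nat_choice)
    show "\<exists>m. m \<in> S" using assms(1) by (simp add: ex_in_conv)
    fix m and n :: nat assume "m \<in> S"
    from step[OF this] show "\<exists>s. s \<in> S \<and> prec m s \<and> s \<noteq> m" .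
  qed
  then obtain C :: "nat \<Rightarrow> 'b" where C: "\<forall>n. C n \<in> S \<and> prec (C n) (C (Suc n)) \<and> C (Suc n) \<noteq> C n" ..
  have "\<exists>N. \<forall>n\<ge>N. C n = C N"
  proof (rule stable)
    show "C n \<in> S" "prec (C n) (C (Suc n))" for n
      using spec[OF C, of n] by simp_all
  qed
  then obtain N where N: "\<forall>n\<ge>N. C n = C N" ..
  have "C (Suc N) = C N"
    using spec[OF N, of "Suc N"] by simp
  then show False
    using spec[OF C, of N] by simp
qed

text \<open>Extremality is judged on the values of \<open>f\<close>, but the parameter attaining it
  is kept: later arguments work with the generator or submodule behind the extremal value.\<close>

lemma extremal_imageD:
  "\<exists>m\<in>f ` S. \<forall>s\<in>f ` S. P m s \<longrightarrow> s = m \<Longrightarrow> \<exists>a\<in>S. \<forall>b\<in>S. P (f a) (f b) \<longrightarrow> f b = f a"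
  by simp

section \<open>Right ideals, sums and the modular law\<close>

context ring
begin

definition right_multiples :: "'a \<Rightarrow> 'a set" where
  "right_multiples x = {x \<otimes> r | r. r \<in> carrier R}"

text \<open>For a right ideal \<open>A\<close> this is the kernel of the map from R to R/A induced
  by left multiplication by \<open>x\<close>.\<close>

definition lmult_preimage :: "'a \<Rightarrow> 'a set \<Rightarrow> 'a set" where
  "lmult_preimage x A = {r \<in> carrier R. x \<otimes> r \<in> A}"

definition right_annihilator :: "'a \<Rightarrow> 'a set" where
  "right_annihilator x = {r \<in> carrier R. x \<otimes> r = \<zero>}"

definition ideal_sum :: "'a set \<Rightarrow> 'a set \<Rightarrow> 'a set" where
  "ideal_sum A B = {a \<oplus> b | a b. a \<in> A \<and> b \<in> B}"

text \<open>Contrapositive of the usual condition that every nonzero right ideal meets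
  \<open>J\<close> nontrivially.\<close>

definition essential :: "'a set \<Rightarrow> bool" where
  "essential J \<longleftrightarrow> (\<forall>U. right_ideal U R \<and> U \<inter> J \<subseteq> {\<zero>} \<longrightarrow> U \<subseteq> {\<zero>})"

text \<open>Expresses that the module B/A is artinian through the right ideals between
  \<open>A\<close> and \<open>B\<close>, so that no quotient module has to be built.\<close>

definition artinian_interval :: "'a set \<Rightarrow> 'a set \<Rightarrow> bool" where
  "artinian_interval A B \<longleftrightarrow>
    (\<forall>C :: nat \<Rightarrow> 'a set.
      (\<forall>n. right_ideal (C n) R \<and> A \<subseteq> C n \<and> C n \<subseteq> B \<and> C (Suc n) \<subseteq> C n)
      \<longrightarrow> (\<exists>N. \<forall>n\<ge>N. C n = C N))"

lemma add_minus_cancel_left: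
  assumes "a \<in> carrier R" "b \<in> carrier R"
  shows "(a \<oplus> b) \<ominus> a = b"
  using assms by (simp add: a_minus_def a_comm[of a b] a_assoc r_neg)

lemma nat_pow_Suc_mult:
  assumes "x \<in> carrier R" "r \<in> carrier R"
  shows "x [^] Suc n \<otimes> r = x \<otimes> (x [^] n \<otimes> r)"
  using assms by (subst nat_pow_Suc2) (simp_all add: m_assoc)

lemma right_idealI:
  assumes "I \<subseteq> carrier R" "\<zero> \<in> I"
    and "\<And>a b. \<lbrakk>a \<in> I; b \<in> I\<rbrakk> \<Longrightarrow> a \<oplus> b \<in> I"
    and mult: "\<And>a r. \<lbrakk>a \<in> I; r \<in> carrier R\<rbrakk> \<Longrightarrow> a \<otimes> r \<in> I"
  shows "right_ideal I R"
proof -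
  have "\<ominus> a \<in> I" if "a \<in> I" for a
  proof -
    have "\<ominus> a = a \<otimes> \<ominus> \<one>"
      using that assms(1) by (metis one_closed r_minus r_one subsetD)
    then show ?thesis
      using mult[OF that] by simp
  qed
  then have "subgroup I (add_monoid R)"
    using assms by (intro add.subgroupI) (auto simp: a_inv_def)
  then show ?thesis
    using mult by (auto intro!: right_ideal.intro additive_subgroup.intro right_ideal_axioms.intro ring_axioms)
qed

lemma left_idealI:
  assumes "I \<subseteq> carrier R" "\<zero> \<in> I"
    and "\<And>a b. \<lbrakk>a \<in> I; b \<in> I\<rbrakk> \<Longrightarrow> a \<oplus> b \<in> I"
    and mult: "\<And>a r. \<lbrakk>a \<in> I; r \<in> carrier R\<rbrakk> \<Longrightarrow> r \<otimes> a \<in> I"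
  shows "left_ideal I R"
proof -
  have "\<ominus> a \<in> I" if "a \<in> I" for a
  proof -
    have "\<ominus> a = \<ominus> \<one> \<otimes> a"
      using that assms(1) by (metis one_closed l_minus l_one subsetD)
    then show ?thesis
      using mult[OF that] by simp
  qed
  then have "subgroup I (add_monoid R)"
    using assms by (intro add.subgroupI) (auto simp: a_inv_def)
  then show ?thesis
    using mult by (auto intro!: left_ideal.intro additive_subgroup.intro left_ideal_axioms.intro ring_axioms)
qed

lemma right_idealD:
  assumes "right_ideal I R"
  shows "I \<subseteq> carrier R" "\<zero> \<in> I"
    and "\<And>a b. \<lbrakk>a \<in> I; b \<in> I\<rbrakk> \<Longrightarrow> a \<oplus> b \<in> I"
    and "\<And>a b. \<lbrakk>a \<in> I; b \<in> I\<rbrakk> \<Longrightarrow> a \<ominus> b \<in> I"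
    and "\<And>a r. \<lbrakk>a \<in> I; r \<in> carrier R\<rbrakk> \<Longrightarrow> a \<otimes> r \<in> I"
proof -
  interpret right_ideal I R by fact
  show "I \<subseteq> carrier R" "\<zero> \<in> I" by (auto simp: a_subset)
  show "\<And>a b. \<lbrakk>a \<in> I; b \<in> I\<rbrakk> \<Longrightarrow> a \<oplus> b \<in> I" by simp
  show "\<And>a b. \<lbrakk>a \<in> I; b \<in> I\<rbrakk> \<Longrightarrow> a \<ominus> b \<in> I"
    by (simp add: a_minus_def)
  show "\<And>a r. \<lbrakk>a \<in> I; r \<in> carrier R\<rbrakk> \<Longrightarrow> a \<otimes> r \<in> I" by (rule I_r_closed)
qed

lemma right_ideal_carrier: "right_ideal (carrier R) R"
  by (rule right_idealI) auto

lemma right_ideal_zero: "right_ideal {\<zero>} R"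
  by (rule right_idealI) auto

lemma right_ideal_image:
  assumes A: "right_ideal A R" and x: "x \<in> carrier R"
  shows "right_ideal ((\<otimes>) x ` A) R"
proof -
  note AD = right_idealD[OF A]
  show ?thesis
  proof (rule right_idealI)
    show "(\<otimes>) x ` A \<subseteq> carrier R" using AD(1) x by auto
    show "\<zero> \<in> (\<otimes>) x ` A" using AD(2) x by (metis imageI r_null)
    fix a b assume "a \<in> (\<otimes>) x ` A" "b \<in> (\<otimes>) x ` A"
    then obtain a' b' where ab: "a' \<in> A" "b' \<in> A" "a = x \<otimes> a'" "b = x \<otimes> b'" by blast
    then have "a \<oplus> b = x \<otimes> (a' \<oplus> b')" using AD(1) x by (simp add: r_distr subset_iff)
    then show "a \<oplus> b \<in> (\<otimes>) x ` A" using ab AD(3) by blast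
  next
    fix a r assume "a \<in> (\<otimes>) x ` A" "r \<in> carrier R"
    then obtain a' where a: "a' \<in> A" "a = x \<otimes> a'" by blast
    then have "a \<otimes> r = x \<otimes> (a' \<otimes> r)" using AD(1) x \<open>r \<in> carrier R\<close> by (simp add: m_assoc subset_iff)
    then show "a \<otimes> r \<in> (\<otimes>) x ` A" using a AD(5) \<open>r \<in> carrier R\<close> by blast
  qed
qed

lemma right_multiples_image: "right_multiples x = (\<otimes>) x ` carrier R"
  by (auto simp: right_multiples_def)

lemma right_ideal_right_multiples:
  "x \<in> carrier R \<Longrightarrow> right_ideal (right_multiples x) R"
  unfolding right_multiples_image by (rule right_ideal_image[OF right_ideal_carrier])

lemma right_multiples_self: "x \<in> carrier R \<Longrightarrow> x \<in> right_multiples x"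
  unfolding right_multiples_def by (metis (mono_tags, lifting) CollectI one_closed r_one)

lemma right_multiples_one: "right_multiples \<one> = carrier R"
  by (auto simp: right_multiples_image)

lemma right_multiples_subset:
  assumes "right_ideal A R" "x \<in> A"
  shows "right_multiples x \<subseteq> A"
  using right_idealD(5)[OF assms] by (auto simp: right_multiples_def)

lemma right_ideal_lmult_preimage:
  assumes A: "right_ideal A R" and x: "x \<in> carrier R"
  shows "right_ideal (lmult_preimage x A) R"
  using right_idealD[OF A] x
  by (intro right_idealI) (auto simp: lmult_preimage_def r_distr m_assoc[symmetric])

lemma right_annihilator_eq: "right_annihilator x = lmult_preimage x {\<zero>}"
  by (auto simp: right_annihilator_def lmult_preimage_def)

lemma right_ideal_right_annihilator:
  "x \<in> carrier R \<Longrightarrow> right_ideal (right_annihilator x) R"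
  unfolding right_annihilator_eq by (rule right_ideal_lmult_preimage[OF right_ideal_zero])

lemma right_ideal_Int:
  assumes "right_ideal A R" "right_ideal B R"
  shows "right_ideal (A \<inter> B) R"
  using right_idealD[OF assms(1)] right_idealD[OF assms(2)]
  by (intro right_idealI) auto

lemma right_ideal_sum:
  assumes A: "right_ideal A R" and B: "right_ideal B R"
  shows "right_ideal (ideal_sum A B) R"
proof -
  note AD = right_idealD[OF A] and BD = right_idealD[OF B]
  show ?thesis
  proof (rule right_idealI)
    show "ideal_sum A B \<subseteq> carrier R"
      using AD(1) BD(1) by (auto simp: ideal_sum_def)
    show "\<zero> \<in> ideal_sum A B"
      unfolding ideal_sum_def using AD(2) BD(2) l_zero[OF zero_closed] by force
    fix u v assume "u \<in> ideal_sum A B" "v \<in> ideal_sum A B"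
    then obtain a b a' b' where
      ab: "a \<in> A" "b \<in> B" "a' \<in> A" "b' \<in> B" "u = a \<oplus> b" "v = a' \<oplus> b'"
      by (auto simp: ideal_sum_def)
    moreover have "a \<in> carrier R" "b \<in> carrier R" "a' \<in> carrier R" "b' \<in> carrier R"
      using ab AD(1) BD(1) by auto
    ultimately have "u \<oplus> v = (a \<oplus> a') \<oplus> (b \<oplus> b')" by (simp add: a_ac)
    then show "u \<oplus> v \<in> ideal_sum A B"
      unfolding ideal_sum_def using ab AD(3) BD(3) by blast
  next
    fix u r assume r: "r \<in> carrier R" and "u \<in> ideal_sum A B"
    then obtain a b where ab: "a \<in> A" "b \<in> B" "u = a \<oplus> b"
      by (auto simp: ideal_sum_def)
    then have "u \<otimes> r = a \<otimes> r \<oplus> b \<otimes> r"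
      using AD(1) BD(1) r by (simp add: l_distr subset_iff)
    then show "u \<otimes> r \<in> ideal_sum A B"
      unfolding ideal_sum_def using ab AD(5) BD(5) r by blast
  qed
qed

lemma ideal_sum_upper:
  assumes "right_ideal A R" "right_ideal B R"
  shows "A \<subseteq> ideal_sum A B" "B \<subseteq> ideal_sum A B"
proof -
  note AD = right_idealD[OF assms(1)] and BD = right_idealD[OF assms(2)]
  show "A \<subseteq> ideal_sum A B"
  proof
    fix a assume a: "a \<in> A"
    then have "a = a \<oplus> \<zero>" using AD(1) by auto
    then show "a \<in> ideal_sum A B" unfolding ideal_sum_def using a BD(2) by blast
  qed
  show "B \<subseteq> ideal_sum A B"
  proof
    fix b assume b: "b \<in> B"
    then have "b = \<zero> \<oplus> b" using BD(1) by auto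
    then show "b \<in> ideal_sum A B" unfolding ideal_sum_def using b AD(2) by blast
  qed
qed

lemma ideal_sum_least:
  assumes "right_ideal C R" "A \<subseteq> C" "B \<subseteq> C"
  shows "ideal_sum A B \<subseteq> C"
  using right_idealD(3)[OF assms(1)] assms(2,3) by (auto simp: ideal_sum_def)

text \<open>By the modular law, D = D \<inter> (C + B) = C + (D \<inter> B) = C. Thus comparable
  right ideals coincide as soon as their intersections and their sums with \<open>B\<close>
  do.\<close>

lemma modular_cancel:
  assumes C: "right_ideal C R" and D: "right_ideal D R" and B: "right_ideal B R"
    and CD: "C \<subseteq> D" and int: "D \<inter> B \<subseteq> C" and sum: "D \<subseteq> ideal_sum C B"
  shows "C = D"
proof
  show "D \<subseteq> C"
  proof
    fix d assume d: "d \<in> D"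
    then obtain c b where cb: "c \<in> C" "b \<in> B" "d = c \<oplus> b"
      using sum by (auto simp: ideal_sum_def)
    have carr: "c \<in> carrier R" "b \<in> carrier R"
      using cb right_idealD(1)[OF C] right_idealD(1)[OF B] by auto
    have "b = d \<ominus> c"
      using cb carr add_minus_cancel_left by simp
    then have "b \<in> C"
      using right_idealD(4)[OF D d, of c] CD cb(1,2) int by auto
    then show "d \<in> C" using cb right_idealD(3)[OF C] by blast
  qed
qed (rule CD)

section \<open>Artinian quotients as chain conditions on intervals\<close>

lemma image_preimage:
  assumes "A \<subseteq> right_multiples x"
  shows "(\<otimes>) x ` lmult_preimage x A = A"
  using assms by (auto simp: lmult_preimage_def right_multiples_def)

text \<open>The map \<open>\<phi>\<close> carries a descending chain into an interval where it
  stabilizes, and injectivity brings the stability back. Injectivity is asked of comparable pairs,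
  which is what a chain offers and what the modular law can deliver.\<close>

lemma artinian_interval_transfer:
  assumes "artinian_interval A B"
    and \<phi>: "\<And>C. \<lbrakk>right_ideal C R; A' \<subseteq> C; C \<subseteq> B'\<rbrakk> \<Longrightarrow>
      right_ideal (\<phi> C) R \<and> A \<subseteq> \<phi> C \<and> \<phi> C \<subseteq> B"
    and mono: "\<And>C D. \<lbrakk>right_ideal C R; right_ideal D R; A' \<subseteq> C; C \<subseteq> D; D \<subseteq> B'\<rbrakk> \<Longrightarrow> \<phi> C \<subseteq> \<phi> D"
    and inj: "\<And>C D. \<lbrakk>right_ideal C R; right_ideal D R; A' \<subseteq> C; C \<subseteq> D; D \<subseteq> B'; \<phi> C = \<phi> D\<rbrakk> \<Longrightarrow> C = D"
  shows "artinian_interval A' B'"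
  unfolding artinian_interval_def
proof (intro allI impI)
  fix C :: "nat \<Rightarrow> 'a set"
  assume C: "\<forall>n. right_ideal (C n) R \<and> A' \<subseteq> C n \<and> C n \<subseteq> B' \<and> C (Suc n) \<subseteq> C n"
  have "\<forall>n. right_ideal (\<phi> (C n)) R \<and> A \<subseteq> \<phi> (C n) \<and> \<phi> (C n) \<subseteq> B \<and> \<phi> (C (Suc n)) \<subseteq> \<phi> (C n)"
    using C \<phi> mono by simp
  then obtain N where N: "\<forall>n\<ge>N. \<phi> (C n) = \<phi> (C N)"
    using assms(1)[unfolded artinian_interval_def, THEN spec, of "\<lambda>n. \<phi> (C n)"] by blast
  have "C n = C N" if "N \<le> n" for n
  proof -
    have "C n \<subseteq> C N" using C that by (simp add: lift_Suc_antimono_le)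
    then show ?thesis using inj[of "C n" "C N"] C N that by blast
  qed
  then show "\<exists>N. \<forall>n\<ge>N. C n = C N" by blast
qed

text \<open>An extension of an artinian module by an artinian module is artinian: the intersections
  of a chain with \<open>B\<close> and its sums with \<open>B\<close> both stabilize, and
  \<open>modular_cancel\<close> then fixes the chain itself.\<close>

lemma artinian_interval_trans:
  assumes AB: "artinian_interval A B" and BC: "artinian_interval B C"
    and B: "right_ideal B R" and C: "right_ideal C R" and sub: "A \<subseteq> B" "B \<subseteq> C"
  shows "artinian_interval A C"
  unfolding artinian_interval_def
proof (intro allI impI)
  fix D :: "nat \<Rightarrow> 'a set"
  assume D: "\<forall>n. right_ideal (D n) R \<and> A \<subseteq> D n \<and> D n \<subseteq> C \<and> D (Suc n) \<subseteq> D n"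
  have "\<forall>n. right_ideal (D n \<inter> B) R \<and> A \<subseteq> D n \<inter> B \<and> D n \<inter> B \<subseteq> B \<and> D (Suc n) \<inter> B \<subseteq> D n \<inter> B"
    using D sub(1) B right_ideal_Int by blast
  then have "\<exists>N. \<forall>n\<ge>N. D n \<inter> B = D N \<inter> B"
    by (rule AB[unfolded artinian_interval_def, THEN spec, THEN mp])
  then obtain N1 where N1: "\<forall>n\<ge>N1. D n \<inter> B = D N1 \<inter> B" ..
  have "ideal_sum (D (Suc n)) B \<subseteq> ideal_sum (D n) B" for n
    using D unfolding ideal_sum_def by blast
  moreover have "ideal_sum (D n) B \<subseteq> C" for n
    using ideal_sum_least[OF C] D sub(2) by simp
  moreover have "right_ideal (ideal_sum (D n) B) R" "B \<subseteq> ideal_sum (D n) B" for n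
    using right_ideal_sum ideal_sum_upper(2) D B by auto
  ultimately have "\<forall>n. right_ideal (ideal_sum (D n) B) R \<and> B \<subseteq> ideal_sum (D n) B \<and>
      ideal_sum (D n) B \<subseteq> C \<and> ideal_sum (D (Suc n)) B \<subseteq> ideal_sum (D n) B"
    by blast
  then have "\<exists>N. \<forall>n\<ge>N. ideal_sum (D n) B = ideal_sum (D N) B"
    by (rule BC[unfolded artinian_interval_def, THEN spec, THEN mp])
  then obtain N2 where N2: "\<forall>n\<ge>N2. ideal_sum (D n) B = ideal_sum (D N2) B" ..
  have "D n = D (max N1 N2)" if n: "max N1 N2 \<le> n" for n
  proof (rule modular_cancel[of _ _ B])
    show "D n \<subseteq> D (max N1 N2)" using D n by (simp add: lift_Suc_antimono_le)
    show "D (max N1 N2) \<inter> B \<subseteq> D n" using N1 n by (metis Int_lower1 max.bounded_iff max.cobounded1)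
    show "D (max N1 N2) \<subseteq> ideal_sum (D n) B"
      using N2 n ideal_sum_upper(1) D B by (metis max.bounded_iff max.cobounded2)
  qed (use D B in auto)
  then show "\<exists>N. \<forall>n\<ge>N. D n = D N" by blast
qed

text \<open>The interval has just two members, so a descending chain either stays at the whole ring
  or remains at \<open>M\<close> once it gets there.\<close>

lemma artinian_interval_maximal:
  assumes "maximal_right_ideal M R"
  shows "artinian_interval M (carrier R)"
  unfolding artinian_interval_def
proof (intro allI impI)
  fix D :: "nat \<Rightarrow> 'a set"
  assume D: "\<forall>n. right_ideal (D n) R \<and> M \<subseteq> D n \<and> D n \<subseteq> carrier R \<and> D (Suc n) \<subseteq> D n"
  have cases: "D n = M \<or> D n = carrier R" for n
    using maximal_right_ideal.I_maximal[OF assms] D by blast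
  show "\<exists>N. \<forall>n\<ge>N. D n = D N"
  proof (cases "\<exists>N. D N = M")
    case True
    then obtain N where N: "D N = M" ..
    have "D n = D N" if "N \<le> n" for n
      using lift_Suc_antimono_le[of D, OF _ that] D N by blast
    then show ?thesis by blast
  next
    case False
    then show ?thesis using cases by metis
  qed
qed

text \<open>A right ideal inside xR is recovered from its preimage under left multiplication by
  \<open>x\<close>, so chains below xR can be tested on their preimages.\<close>

lemma artinian_interval_lmult:
  assumes x: "x \<in> carrier R" and art: "artinian_interval (lmult_preimage x A) (carrier R)"
  shows "artinian_interval A (right_multiples x)"
proof (rule artinian_interval_transfer[OF art, where \<phi> = "lmult_preimage x"])
  fix C D assume "C \<subseteq> D" "D \<subseteq> right_multiples x" "lmult_preimage x C = lmult_preimage x D"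
  then show "C = D" using image_preimage by (metis order.trans)
qed (use x right_ideal_lmult_preimage in \<open>auto simp: lmult_preimage_def\<close>)

text \<open>Induction along x^(m+1)R \<subseteq> xR \<subseteq> R. The upper factor is simple, and
  the lower one is a quotient of R/x^m R by way of left multiplication by \<open>x\<close>.\<close>

lemma artinian_interval_power:
  assumes x: "x \<in> carrier R" and max: "maximal_right_ideal (right_multiples x) R"
  shows "artinian_interval (right_multiples (x [^] (m::nat))) (carrier R)"
proof (induction m)
  case 0
  have "artinian_interval (carrier R) (carrier R)"
    unfolding artinian_interval_def by blast
  then show ?case by (simp add: right_multiples_one)
next
  case (Suc m)
  have assoc: "x [^] Suc m \<otimes> r = x \<otimes> (x [^] m \<otimes> r)" if "r \<in> carrier R" for r
    using nat_pow_Suc_mult[OF x that] .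
  \<comment> \<open>Only an inclusion, because the preimage also contains the right annihilator of
    \<open>x\<close>.\<close>
  have sub: "right_multiples (x [^] m) \<subseteq> lmult_preimage x (right_multiples (x [^] Suc m))"
  proof
    fix a assume "a \<in> right_multiples (x [^] m)"
    then obtain r where r: "r \<in> carrier R" "a = x [^] m \<otimes> r" by (auto simp: right_multiples_def)
    then have "x \<otimes> a = x [^] Suc m \<otimes> r" using assoc by simp
    then show "a \<in> lmult_preimage x (right_multiples (x [^] Suc m))"
      unfolding lmult_preimage_def right_multiples_def using r x by auto
  qed
  have "artinian_interval (lmult_preimage x (right_multiples (x [^] Suc m))) (carrier R)"
    by (rule artinian_interval_transfer[OF Suc.IH, where \<phi> = "\<lambda>C. C"]) (use sub in auto)
  then have "artinian_interval (right_multiples (x [^] Suc m)) (right_multiples x)"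
    by (rule artinian_interval_lmult[OF x])
  moreover have "right_multiples (x [^] Suc m) \<subseteq> right_multiples x"
  proof
    fix a assume "a \<in> right_multiples (x [^] Suc m)"
    then obtain r where r: "r \<in> carrier R" "a = x [^] Suc m \<otimes> r" by (auto simp: right_multiples_def)
    then have "a = x \<otimes> (x [^] m \<otimes> r)" using assoc by simp
    then show "a \<in> right_multiples x"
      unfolding right_multiples_def using r x by auto
  qed
  ultimately show ?case
    using artinian_interval_trans artinian_interval_maximal[OF max] right_ideal_right_multiples[OF x]
      right_ideal_carrier right_idealD(1) by blast
qed

text \<open>Since \<open>N\<close> meets \<open>P\<close> trivially, it embeds into the artinian
  module R/P, and (J + N)/J is a quotient of \<open>N\<close>. On intervals, the composite sends
  \<open>C\<close> to (C \<inter> N) + P.\<close>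

lemma artinian_interval_sum:
  assumes J: "right_ideal J R" and N: "right_ideal N R" and P: "right_ideal P R"
    and art: "artinian_interval P (carrier R)" and disj: "N \<inter> P \<subseteq> {\<zero>}"
  shows "artinian_interval J (ideal_sum J N)"
proof (rule artinian_interval_transfer[OF art, where \<phi> = "\<lambda>C. ideal_sum (C \<inter> N) P"])
  fix C assume "right_ideal C R"
  then show "right_ideal (ideal_sum (C \<inter> N) P) R \<and> P \<subseteq> ideal_sum (C \<inter> N) P \<and>
      ideal_sum (C \<inter> N) P \<subseteq> carrier R"
    using N P right_ideal_Int right_ideal_sum ideal_sum_upper(2) right_idealD(1) by presburger
next
  fix C D :: "'a set" assume "C \<subseteq> D"
  then show "ideal_sum (C \<inter> N) P \<subseteq> ideal_sum (D \<inter> N) P"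
    by (auto simp: ideal_sum_def)
next
  fix C D
  assume C: "right_ideal C R" and D: "right_ideal D R" and sub: "J \<subseteq> C" "C \<subseteq> D" "D \<subseteq> ideal_sum J N"
    and eq: "ideal_sum (C \<inter> N) P = ideal_sum (D \<inter> N) P"
  \<comment> \<open>The modular law is applied twice: first to cancel \<open>P\<close> from the
    sums, then to pass from the intersections with \<open>N\<close> to \<open>C\<close> and
    \<open>D\<close> themselves.\<close>
  have "C \<inter> N = D \<inter> N"
  proof (rule modular_cancel[of _ _ P])
    show "D \<inter> N \<inter> P \<subseteq> C \<inter> N"
      using disj right_idealD(2)[OF right_ideal_Int[OF C N]] by blast
    show "D \<inter> N \<subseteq> ideal_sum (C \<inter> N) P"
      using eq ideal_sum_upper(1)[OF right_ideal_Int[OF D N] P] by simp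
  qed (use C D N P right_ideal_Int sub in auto)
  moreover have "D \<subseteq> ideal_sum C N"
    using sub unfolding ideal_sum_def by blast
  ultimately show "C = D"
    using sub N C D by (intro modular_cancel[of _ _ N]) auto
qed

text \<open>Take zR minimal among the principal right ideals containing \<open>J\<close> and write J
  = zK. If \<open>K\<close> were proper, it would lie in a proper xR, and zxR would still contain
  \<open>J\<close>; minimality then forces zxR = zR, which puts \<open>\<one>\<close> into
  xR.\<close>

lemma principal_if_artinian:
  assumes exmax: "\<And>I. \<lbrakk>right_ideal I R; I \<noteq> carrier R\<rbrakk> \<Longrightarrow>
      \<exists>x\<in>carrier R. I \<subseteq> right_multiples x \<and> right_multiples x \<noteq> carrier R"
    and J: "right_ideal J R" and art: "artinian_interval J (carrier R)"
  shows "\<exists>z\<in>carrier R. J = right_multiples z"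
proof -
  let ?S = "right_multiples ` {z \<in> carrier R. J \<subseteq> right_multiples z}"
  have "J \<subseteq> right_multiples \<one>"
    using right_idealD(1)[OF J] by (simp add: right_multiples_one)
  then have "?S \<noteq> {}" by blast
  then have "\<exists>m\<in>?S. \<forall>s\<in>?S. s \<subseteq> m \<longrightarrow> s = m"
  proof (rule stable_chains_extremal)
    fix C :: "nat \<Rightarrow> 'a set"
    assume C: "\<And>n. C n \<in> ?S" "\<And>n. C (Suc n) \<subseteq> C n"
    have "right_ideal (C n) R \<and> J \<subseteq> C n" for n
      using C(1)[of n] right_ideal_right_multiples by auto
    then have "\<forall>n. right_ideal (C n) R \<and> J \<subseteq> C n \<and> C n \<subseteq> carrier R \<and> C (Suc n) \<subseteq> C n"
      using C(2) right_idealD(1) by blast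
    then show "\<exists>N. \<forall>n\<ge>N. C n = C N"
      using art[unfolded artinian_interval_def, THEN spec, of C] by blast
  qed
  from extremal_imageD[OF this] obtain z where z: "z \<in> carrier R" "J \<subseteq> right_multiples z"
    and min: "\<And>w. \<lbrakk>w \<in> carrier R; J \<subseteq> right_multiples w; right_multiples w \<subseteq> right_multiples z\<rbrakk>
      \<Longrightarrow> right_multiples w = right_multiples z"
    by (metis (mono_tags, lifting) mem_Collect_eq)
  let ?K = "lmult_preimage z J"
  have K: "right_ideal ?K R" by (rule right_ideal_lmult_preimage[OF J z(1)])
  have JK: "J = (\<otimes>) z ` ?K" using image_preimage[OF z(2)] by simp
  have "?K = carrier R"
  proof (rule ccontr)
    assume "?K \<noteq> carrier R"
    then obtain x where x: "x \<in> carrier R" "?K \<subseteq> right_multiples x" "right_multiples x \<noteq> carrier R"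
      using exmax[OF K] by blast
    have "J \<subseteq> right_multiples (z \<otimes> x)"
    proof
      fix j assume "j \<in> J"
      then obtain k where k: "j = z \<otimes> k" "k \<in> ?K" using JK by blast
      then obtain r where "k = x \<otimes> r" "r \<in> carrier R"
        using x(2) by (auto simp: right_multiples_def)
      then show "j \<in> right_multiples (z \<otimes> x)"
        using k z(1) x(1) m_assoc[of z x r, symmetric] by (auto simp: right_multiples_def)
    qed
    moreover have "right_multiples (z \<otimes> x) \<subseteq> right_multiples z"
      using z(1) x(1) by (auto simp: right_multiples_def m_assoc)
    ultimately have "right_multiples (z \<otimes> x) = right_multiples z"
      using min[of "z \<otimes> x"] z(1) x(1) by simp
    then have "z \<in> right_multiples (z \<otimes> x)"
      using right_multiples_self[OF z(1)] by simp
    then obtain r where r: "r \<in> carrier R" "z = z \<otimes> (x \<otimes> r)"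
      using z(1) x(1) by (auto simp: right_multiples_def m_assoc)
    \<comment> \<open>Everything annihilated by \<open>z\<close> lies in \<open>?K\<close>, hence in
      xR; so \<open>\<one>\<close> is a sum of two elements of xR.\<close>
    have "z \<otimes> (\<one> \<ominus> x \<otimes> r) = \<zero>"
      using r z(1) x(1) by (simp add: a_minus_def r_distr r_minus r_neg)
    then have "\<one> \<ominus> x \<otimes> r \<in> ?K"
      using right_idealD(2)[OF J] r x by (simp add: lmult_preimage_def)
    then have "\<one> \<ominus> x \<otimes> r \<in> right_multiples x" using x(2) by blast
    moreover have "x \<otimes> r \<in> right_multiples x"
      using r by (auto simp: right_multiples_def)
    ultimately have "(\<one> \<ominus> x \<otimes> r) \<oplus> x \<otimes> r \<in> right_multiples x"
      using right_idealD(3)[OF right_ideal_right_multiples[OF x(1)]] by blast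
    then have "\<one> \<in> right_multiples x"
      using r x by (simp add: a_minus_def a_assoc l_neg)
    then have "right_multiples \<one> \<subseteq> right_multiples x"
      by (rule right_multiples_subset[OF right_ideal_right_multiples[OF x(1)]])
    then show False
      using x(1,3) right_idealD(1)[OF right_ideal_right_multiples[OF x(1)]]
      by (simp add: right_multiples_one)
  qed
  then show ?thesis
    using JK z(1) right_multiples_image by auto
qed

section \<open>Left submodules of a finite power of the ring\<close>

definition left_submodule :: "'i set \<Rightarrow> ('i \<Rightarrow> 'a) set \<Rightarrow> bool" where
  "left_submodule X U \<longleftrightarrow>
    (\<forall>f\<in>U. \<forall>i. f i \<in> carrier R) \<and> (\<forall>f\<in>U. \<forall>i. i \<notin> X \<longrightarrow> f i = \<zero>) \<and> (\<lambda>_. \<zero>) \<in> U \<and>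
    (\<forall>f\<in>U. \<forall>g\<in>U. (\<lambda>i. f i \<oplus> g i) \<in> U) \<and>
    (\<forall>f\<in>U. \<forall>r\<in>carrier R. (\<lambda>i. r \<otimes> f i) \<in> U)"

lemma left_submoduleD:
  assumes "left_submodule X U"
  shows "\<And>f i. f \<in> U \<Longrightarrow> f i \<in> carrier R"
    and "\<And>f i. \<lbrakk>f \<in> U; i \<notin> X\<rbrakk> \<Longrightarrow> f i = \<zero>"
    and "(\<lambda>_. \<zero>) \<in> U"
    and "\<And>f g. \<lbrakk>f \<in> U; g \<in> U\<rbrakk> \<Longrightarrow> (\<lambda>i. f i \<oplus> g i) \<in> U"
    and "\<And>f r. \<lbrakk>f \<in> U; r \<in> carrier R\<rbrakk> \<Longrightarrow> (\<lambda>i. r \<otimes> f i) \<in> U"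
proof -
  note U = assms[unfolded left_submodule_def]
  show "f i \<in> carrier R" if "f \<in> U" for f i
    using U[THEN conjunct1, rule_format, OF that] .
  show "f i = \<zero>" if "f \<in> U" "i \<notin> X" for f i
    using U[THEN conjunct2, THEN conjunct1, rule_format, OF that] .
  show "(\<lambda>_. \<zero>) \<in> U"
    using U[THEN conjunct2, THEN conjunct2, THEN conjunct1] .
  show "(\<lambda>i. f i \<oplus> g i) \<in> U" if "f \<in> U" "g \<in> U" for f g
    using U[THEN conjunct2, THEN conjunct2, THEN conjunct2, THEN conjunct1, rule_format, OF that] .
  show "(\<lambda>i. r \<otimes> f i) \<in> U" if "f \<in> U" "r \<in> carrier R" for f r
    using U[THEN conjunct2, THEN conjunct2, THEN conjunct2, THEN conjunct2, rule_format, OF that] .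
qed

text \<open>This is the cyclic submodule Rc of R^X. Tuples are total functions with value zero off
  \<open>X\<close>, so the values of \<open>c\<close> there have no influence.\<close>

lemma left_submodule_multiples:
  assumes "\<And>i. i \<in> X \<Longrightarrow> c i \<in> carrier R"
  shows "left_submodule X {\<lambda>i. if i \<in> X then r \<otimes> c i else \<zero> | r. r \<in> carrier R}" (is "left_submodule X ?U")
  unfolding left_submodule_def
proof (intro conjI ballI)
  show "(\<lambda>_. \<zero>) \<in> ?U"
    using assms by (intro CollectI exI[of _ \<zero>]) auto
  fix f assume "f \<in> ?U"
  then obtain r where r: "r \<in> carrier R" "f = (\<lambda>i. if i \<in> X then r \<otimes> c i else \<zero>)" by blast
  show "\<forall>i. f i \<in> carrier R" "\<forall>i. i \<notin> X \<longrightarrow> f i = \<zero>"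
    using r assms by auto
  {
    fix g assume "g \<in> ?U"
    then obtain s where s: "s \<in> carrier R" "g = (\<lambda>i. if i \<in> X then s \<otimes> c i else \<zero>)" by blast
    have "(\<lambda>i. f i \<oplus> g i) = (\<lambda>i. if i \<in> X then (r \<oplus> s) \<otimes> c i else \<zero>)"
      using r s assms by (auto simp: l_distr)
    then show "(\<lambda>i. f i \<oplus> g i) \<in> ?U" using r s by blast
  next
    fix s assume s: "s \<in> carrier R"
    have "(\<lambda>i. s \<otimes> f i) = (\<lambda>i. if i \<in> X then (s \<otimes> r) \<otimes> c i else \<zero>)"
      using r s assms by (auto simp: m_assoc)
    then show "(\<lambda>i. s \<otimes> f i) \<in> ?U" using r s by blast
  }
qed

end

text \<open>A finite power of a left noetherian ring is a noetherian left module. In the induction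
  step, first maximize the left ideal of values at the new index \<open>a\<close>, then, among
  submodules attaining it, the kernel of evaluation at \<open>a\<close>. A larger submodule with the
  same values and the same kernel is equal.\<close>

lemma (in left_noetherian_ring) left_submodule_maximal:
  fixes X :: "'i set" and S :: "('i \<Rightarrow> 'a) set set"
  assumes "finite X" "S \<noteq> {}" "\<And>U. U \<in> S \<Longrightarrow> left_submodule X U"
  shows "\<exists>M\<in>S. \<forall>U\<in>S. M \<subseteq> U \<longrightarrow> U = M"
  using assms
proof (induction X arbitrary: S rule: finite_induct)
  case empty
  have "U = {\<lambda>_. \<zero>}" if "U \<in> S" for U
  proof -
    note U = left_submoduleD[OF empty(2)[OF that]]
    have "f = (\<lambda>_. \<zero>)" if "f \<in> U" for f
      using U(2)[OF that] by auto
    then show ?thesis using U(3) by blast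
  qed
  then show ?case using empty(1) by blast
next
  case (insert a X)
  define coord where "coord = (\<lambda>U :: ('i \<Rightarrow> 'a) set. (\<lambda>f. f a) ` U)"
  define ker where "ker = (\<lambda>U :: ('i \<Rightarrow> 'a) set. {f \<in> U. f a = \<zero>})"
  have coord: "left_ideal (coord U) R" if "U \<in> S" for U
  proof (rule left_idealI)
    note U = left_submoduleD[OF insert.prems(2)[OF that]]
    show "coord U \<subseteq> carrier R" using U(1) by (auto simp: coord_def)
    show "\<zero> \<in> coord U" using imageI[OF U(3), of "\<lambda>f. f a"] by (simp add: coord_def)
    fix u assume "u \<in> coord U"
    then obtain f where f: "f \<in> U" "u = f a" by (auto simp: coord_def)
    {
      fix v assume "v \<in> coord U"
      then obtain g where g: "g \<in> U" "v = g a" by (auto simp: coord_def)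
      show "u \<oplus> v \<in> coord U"
        using f g imageI[OF U(4)[OF f(1) g(1)], of "\<lambda>f. f a"] by (simp add: coord_def)
    next
      fix r assume r: "r \<in> carrier R"
      show "r \<otimes> u \<in> coord U"
        using f imageI[OF U(5)[OF f(1) r], of "\<lambda>f. f a"] by (simp add: coord_def)
    }
  qed
  have ker: "left_submodule X (ker U)" if "U \<in> S" for U
  proof -
    note U = left_submoduleD[OF insert.prems(2)[OF that]]
    have "f i \<in> carrier R" if "f \<in> ker U" for f i
      using that U(1)[of f i] by (simp add: ker_def)
    moreover have "f i = \<zero>" if "f \<in> ker U" "i \<notin> X" for f i
      using that U(2)[of f i] by (cases "i = a") (simp_all add: ker_def)
    moreover have "(\<lambda>_. \<zero>) \<in> ker U"
      using U(3) by (simp add: ker_def)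
    moreover have "(\<lambda>i. f i \<oplus> g i) \<in> ker U" if "f \<in> ker U" "g \<in> ker U" for f g
      using that U(4)[of f g] by (simp add: ker_def)
    moreover have "(\<lambda>i. r \<otimes> f i) \<in> ker U" if "f \<in> ker U" "r \<in> carrier R" for f r
      using that U(5)[of f r] by (simp add: ker_def)
    ultimately show ?thesis
      unfolding left_submodule_def by (intro conjI ballI allI impI)
  qed
  have "\<exists>m\<in>coord ` S. \<forall>s\<in>coord ` S. m \<subseteq> s \<longrightarrow> s = m"
  proof (rule stable_chains_extremal)
    fix C :: "nat \<Rightarrow> 'a set"
    assume "\<And>n. C n \<in> coord ` S" "\<And>n. C n \<subseteq> C (Suc n)"
    moreover have "left_ideal (C n) R" for n
      using calculation(1)[of n] coord by auto
    ultimately show "\<exists>N. \<forall>n\<ge>N. C n = C N"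
      using left_acc[of C] by simp
  qed (use insert.prems(1) in blast)
  from extremal_imageD[OF this] obtain U where U: "U \<in> S" "\<And>V. \<lbrakk>V \<in> S; coord U \<subseteq> coord V\<rbrakk> \<Longrightarrow> coord V = coord U"
    by (metis (mono_tags, lifting) mem_Collect_eq)
  let ?S = "ker ` {V \<in> S. coord V = coord U}"
  have "\<exists>M\<in>?S. \<forall>V\<in>?S. M \<subseteq> V \<longrightarrow> V = M"
    using insert.IH[of ?S] ker U(1) by blast
  from extremal_imageD[OF this] obtain M where M: "M \<in> S" "coord M = coord U"
    "\<And>V. \<lbrakk>V \<in> S; coord V = coord U; ker M \<subseteq> ker V\<rbrakk> \<Longrightarrow> ker V = ker M"
    by (metis (mono_tags, lifting) mem_Collect_eq)
  have "V = M" if V: "V \<in> S" "M \<subseteq> V" for V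
  proof
    have cV: "coord V = coord U"
      using U(2)[OF V(1)] M(2) V(2) image_mono[OF V(2), of "\<lambda>f. f a"] by (simp add: coord_def)
    have kV: "ker V = ker M" using M(3)[OF V(1) cV] V(2) by (auto simp: ker_def)
    note VD = left_submoduleD[OF insert.prems(2)[OF V(1)]]
      and MD = left_submoduleD[OF insert.prems(2)[OF M(1)]]
    show "V \<subseteq> M"
    proof
      fix v assume v: "v \<in> V"
      then have "v a \<in> coord M" using cV M(2) by (auto simp: coord_def)
      then obtain u where u: "u \<in> M" "u a = v a" by (auto simp: coord_def)
      have vc: "v i \<in> carrier R" and uc: "u i \<in> carrier R" for i
        using VD(1)[OF v] MD(1)[OF u(1)] by auto
      \<comment> \<open>The difference v - u is formed with the scalar
        \<open>\<ominus> \<one>\<close>. It vanishes at \<open>a\<close>, so it lies in the common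
        kernel and thus in \<open>M\<close>.\<close>
      have "(\<lambda>i. \<ominus> \<one> \<otimes> u i) \<in> V"
        using VD(5)[OF subsetD[OF V(2) u(1)]] by simp
      from VD(4)[OF v this] have "(\<lambda>i. v i \<oplus> \<ominus> \<one> \<otimes> u i) \<in> V" .
      then have "(\<lambda>i. v i \<oplus> \<ominus> \<one> \<otimes> u i) \<in> ker V"
        using u vc uc by (simp add: ker_def l_minus r_neg)
      then have "(\<lambda>i. v i \<oplus> \<ominus> \<one> \<otimes> u i) \<in> M" unfolding kV by (simp add: ker_def)
      from MD(4)[OF this u(1)] have "(\<lambda>i. (v i \<oplus> \<ominus> \<one> \<otimes> u i) \<oplus> u i) \<in> M" .
      then show "v \<in> M"
        using vc uc by (simp add: l_minus a_assoc l_neg)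
    qed
  qed (rule V(2))
  then show ?case using M(1) by blast
qed

section \<open>Consequences of the ascending chain condition on right ideals\<close>

context right_noetherian_ring
begin

lemma right_ideal_maximal_element:
  assumes "S \<noteq> {}" "\<And>I. I \<in> S \<Longrightarrow> right_ideal I R"
  obtains M where "M \<in> S" "\<And>I. \<lbrakk>I \<in> S; M \<subseteq> I\<rbrakk> \<Longrightarrow> I = M"
proof -
  have "\<exists>M\<in>S. \<forall>I\<in>S. M \<subseteq> I \<longrightarrow> I = M"
    using assms(1)
  proof (rule stable_chains_extremal)
    fix C :: "nat \<Rightarrow> 'a set"
    assume "\<And>n. C n \<in> S" "\<And>n. C n \<subseteq> C (Suc n)"
    then show "\<exists>N. \<forall>n\<ge>N. C n = C N" using right_acc[of C] assms(2) by simp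
  qed
  then show ?thesis using that by metis
qed

text \<open>A maximal member among the right ideals spanned by finite subsets of \<open>J\<close>
  absorbs every element of \<open>J\<close>. Generation is stated by a universal property, which
  later transports along left multiplication without handling linear combinations.\<close>

lemma right_ideal_finitely_generated:
  assumes J: "right_ideal J R"
  obtains X where "finite X" "X \<subseteq> J" "\<And>B. \<lbrakk>right_ideal B R; X \<subseteq> B\<rbrakk> \<Longrightarrow> J \<subseteq> B"
proof -
  define span where "span = (\<lambda>X. \<Inter>{B. right_ideal B R \<and> X \<subseteq> B})"
  have span: "right_ideal (span X) R" "X \<subseteq> span X" if "X \<subseteq> J" for X
  proof -
    have "span X \<subseteq> carrier R"
      using that right_idealD(1)[OF J] right_ideal_carrier by (auto simp: span_def)
    then show "right_ideal (span X) R"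
      by (intro right_idealI) (auto simp: span_def dest: right_idealD)
  qed (auto simp: span_def)
  let ?S = "span ` {X. finite X \<and> X \<subseteq> J}"
  obtain M where M: "M \<in> ?S" and max: "\<And>I. \<lbrakk>I \<in> ?S; M \<subseteq> I\<rbrakk> \<Longrightarrow> I = M"
    by (rule right_ideal_maximal_element[of ?S, OF _ _ that]) (use span(1) in auto)
  then obtain X where X: "finite X" "X \<subseteq> J" "M = span X" by auto
  have "J \<subseteq> span X"
  proof
    fix j assume j: "j \<in> J"
    have "span X \<subseteq> span (insert j X)" by (auto simp: span_def)
    then have "span (insert j X) = span X"
      using max[of "span (insert j X)"] X j by simp
    then show "j \<in> span X"
      using span(2)[of "insert j X"] X j by blast
  qed
  then have "J \<subseteq> B" if "right_ideal B R" "X \<subseteq> B" for B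
    using that by (auto simp: span_def)
  then show ?thesis using that X by blast
qed

text \<open>The right annihilators of the powers of \<open>x\<close> ascend; the Fitting-type
  arguments below rest on this stable exponent.\<close>

lemma right_annihilator_power_stable:
  assumes x: "x \<in> carrier R"
  shows "\<exists>N::nat. \<forall>n\<ge>N. right_annihilator (x [^] n) = right_annihilator (x [^] N)"
proof -
  have mono: "right_annihilator (x [^] n) \<subseteq> right_annihilator (x [^] Suc n)" for n :: nat
  proof
    fix r assume "r \<in> right_annihilator (x [^] n)"
    then have "r \<in> carrier R" "x \<otimes> (x [^] n \<otimes> r) = \<zero>" using x by (auto simp: right_annihilator_def)
    then show "r \<in> right_annihilator (x [^] Suc n)"
      using nat_pow_Suc_mult[OF x] by (simp add: right_annihilator_def del: nat_pow_Suc)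
  qed
  have "right_ideal (right_annihilator (x [^] n)) R" for n :: nat
    using right_ideal_right_annihilator x by simp
  then show ?thesis
    by (rule right_acc[of "\<lambda>n. right_annihilator (x [^] n)", OF _ mono])
qed

text \<open>As in the proof that surjective endomorphisms of noetherian modules are injective: A
  \<subseteq> xA yields a = x^N b for the stable exponent \<open>N\<close>. Then xa = 0 says x^(N+1)
  b = 0, whence x^N b = 0.\<close>

lemma lmult_surj_imp_inj:
  assumes x: "x \<in> carrier R" and A: "right_ideal A R" and surj: "A \<subseteq> (\<otimes>) x ` A"
    and a: "a \<in> A" "x \<otimes> a = \<zero>"
  shows "a = \<zero>"
proof -
  from right_annihilator_power_stable[OF x]
  obtain N :: nat where N: "\<forall>n\<ge>N. right_annihilator (x [^] n) = right_annihilator (x [^] N)" ..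
  have AC: "A \<subseteq> carrier R" by (rule right_idealD(1)[OF A])
  have "\<exists>b\<in>A. a = x [^] n \<otimes> b" for n :: nat
  proof (induction n)
    case 0
    then show ?case using a AC by (auto intro!: bexI[of _ a])
  next
    case (Suc n)
    then obtain b where b: "b \<in> A" "a = x [^] n \<otimes> b" by blast
    then obtain b' where b': "b' \<in> A" "b = x \<otimes> b'" using surj by blast
    then have "a = x [^] Suc n \<otimes> b'" using b x AC by (auto simp: m_assoc)
    then show ?case using b' by blast
  qed
  then obtain b where b: "b \<in> A" "a = x [^] N \<otimes> b" by blast
  then have "x [^] Suc N \<otimes> b = \<zero>"
    using a(2) nat_pow_Suc_mult[OF x, of b N] AC by auto
  then have "b \<in> right_annihilator (x [^] Suc N)"
    using b AC by (auto simp: right_annihilator_def)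
  then have "b \<in> right_annihilator (x [^] N)" using N[rule_format, of "Suc N"] by simp
  then show ?thesis using b by (simp add: right_annihilator_def)
qed

text \<open>Left multiplication by \<open>s\<close> is onto, because s(xr) = r, hence it is
  injective; and it sends xs - 1 to zero.\<close>

lemma left_inverse_imp_right_inverse:
  assumes "s \<in> carrier R" "x \<in> carrier R" "s \<otimes> x = \<one>"
  shows "x \<otimes> s = \<one>"
proof -
  have "r = s \<otimes> (x \<otimes> r)" if "r \<in> carrier R" for r
    using that assms by (simp add: m_assoc[symmetric])
  then have surj: "carrier R \<subseteq> (\<otimes>) s ` carrier R"
    using assms by blast
  have "s \<otimes> (x \<otimes> s) = s"
    using assms by (simp add: m_assoc[symmetric])
  then have "s \<otimes> (x \<otimes> s \<ominus> \<one>) = \<zero>"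
    using assms by (simp add: a_minus_def r_distr r_minus r_neg)
  then have "x \<otimes> s \<ominus> \<one> = \<zero>"
    using lmult_surj_imp_inj[OF assms(1) right_ideal_carrier surj] assms by simp
  then show ?thesis using assms(1,2) by simp
qed

lemma exists_maximal_right_ideal:
  assumes "right_ideal I R" "I \<noteq> carrier R"
  obtains M where "maximal_right_ideal M R" "I \<subseteq> M"
proof -
  let ?S = "{M. right_ideal M R \<and> I \<subseteq> M \<and> M \<noteq> carrier R}"
  obtain M where "M \<in> ?S" and max: "\<And>J. \<lbrakk>J \<in> ?S; M \<subseteq> J\<rbrakk> \<Longrightarrow> J = M"
    by (rule right_ideal_maximal_element[of ?S, OF _ _ that]) (use assms in auto)
  then have M: "right_ideal M R" "I \<subseteq> M" "M \<noteq> carrier R" by auto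
  have "J = M \<or> J = carrier R" if "right_ideal J R" "M \<subseteq> J" for J
    using max[of J] M(2) that by auto
  then have "maximal_right_ideal M R"
    using M(1,3) by (intro maximal_right_ideal.intro maximal_right_ideal_axioms.intro) auto
  then show ?thesis using that M by blast
qed

text \<open>An element annihilating an essential right ideal on the left lies in the right singular
  ideal, which is nil because annihilators of powers stabilize.\<close>

lemma nilpotent_if_annihilates_essential:
  assumes u: "u \<in> carrier R" and J: "right_ideal J R" "essential J"
    and uJ: "\<And>j. j \<in> J \<Longrightarrow> u \<otimes> j = \<zero>"
  shows "\<exists>m::nat. u [^] m = \<zero>"
proof -
  from right_annihilator_power_stable[OF u]
  obtain N :: nat where N: "\<forall>n\<ge>N. right_annihilator (u [^] n) = right_annihilator (u [^] N)" ..
  have uN: "u [^] N \<in> carrier R" using u by simp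
  \<comment> \<open>An element u^N r of \<open>J\<close> is killed by \<open>u\<close>, so
    \<open>r\<close> annihilates u^(N+1) and, by stability, already u^N.\<close>
  have "right_multiples (u [^] N) \<inter> J \<subseteq> {\<zero>}"
  proof
    fix a assume "a \<in> right_multiples (u [^] N) \<inter> J"
    then obtain r where r: "r \<in> carrier R" "a = u [^] N \<otimes> r" "a \<in> J"
      by (auto simp: right_multiples_def)
    then have "u [^] Suc N \<otimes> r = \<zero>"
      using uJ[of a] nat_pow_Suc_mult[OF u, of r N] by simp
    then have "r \<in> right_annihilator (u [^] N)"
      using N[rule_format, of "Suc N"] r(1) by (auto simp: right_annihilator_def)
    then show "a \<in> {\<zero>}" using r by (simp add: right_annihilator_def)
  qed
  then have "right_multiples (u [^] N) \<subseteq> {\<zero>}"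
    using J(2) right_ideal_right_multiples[OF uN] by (simp add: essential_def)
  then show ?thesis using right_multiples_self[OF uN] by blast
qed

text \<open>Choose \<open>C\<close> maximal with trivial intersection with \<open>I\<close>. If
  \<open>U\<close> meets I + C trivially, then C + U still meets \<open>I\<close> trivially, so
  maximality gives U \<subseteq> C and therefore U = 0.\<close>

lemma exists_essential_complement:
  assumes I: "right_ideal I R"
  obtains C where "right_ideal C R" "I \<inter> C \<subseteq> {\<zero>}" "essential (ideal_sum I C)"
proof -
  let ?S = "{C. right_ideal C R \<and> I \<inter> C \<subseteq> {\<zero>}}"
  obtain C where "C \<in> ?S" and max: "\<And>D. \<lbrakk>D \<in> ?S; C \<subseteq> D\<rbrakk> \<Longrightarrow> D = C"
    by (rule right_ideal_maximal_element[of ?S, OF _ _ that]) (use right_ideal_zero in auto)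
  then have C: "right_ideal C R" "I \<inter> C \<subseteq> {\<zero>}" by auto
  have "U \<subseteq> {\<zero>}" if U: "right_ideal U R" "U \<inter> ideal_sum I C \<subseteq> {\<zero>}" for U
  proof -
    note carr = right_idealD(1)[OF I] right_idealD(1)[OF C(1)] right_idealD(1)[OF U(1)]
    have "I \<inter> ideal_sum C U \<subseteq> {\<zero>}"
    proof
      fix i assume "i \<in> I \<inter> ideal_sum C U"
      then obtain c u where cu: "i \<in> I" "c \<in> C" "u \<in> U" "i = c \<oplus> u"
        by (auto simp: ideal_sum_def)
      then have car: "i \<in> carrier R" "c \<in> carrier R" "u \<in> carrier R" using carr by auto
      have "\<zero> \<ominus> c \<in> C"
        using right_idealD(4)[OF C(1) right_idealD(2)[OF C(1)] cu(2)] .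
      moreover have "u = i \<oplus> (\<zero> \<ominus> c)"
        using add_minus_cancel_left[OF car(2,3)] cu(4) car by (simp add: a_minus_def)
      ultimately have "u \<in> ideal_sum I C" using cu(1) by (auto simp: ideal_sum_def)
      then have "u = \<zero>" using U(2) cu(3) by blast
      then show "i \<in> {\<zero>}" using cu car C(2) by auto
    qed
    then have "ideal_sum C U = C"
      using max right_ideal_sum[OF C(1) U(1)] ideal_sum_upper[OF C(1) U(1)] by blast
    then have "U \<subseteq> C" using ideal_sum_upper(2)[OF C(1) U(1)] by simp
    then show ?thesis using U(2) ideal_sum_upper(2)[OF I C(1)] by blast
  qed
  then have "essential (ideal_sum I C)" by (auto simp: essential_def)
  then show ?thesis using that C by blast
qed

section \<open>Critical right ideals and division by a generator\<close>

definition critical :: "'a set \<Rightarrow> bool" where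
  "critical J \<longleftrightarrow> right_ideal J R \<and> essential J \<and> \<not> artinian_interval J (carrier R) \<and>
    (\<forall>A. right_ideal A R \<and> J \<subset> A \<longrightarrow> artinian_interval A (carrier R))"

text \<open>By Fitting's argument some right annihilator of \<open>x\<^sup>m\<close> embeds into the artinian module
  \<open>R/x\<^sup>mR\<close>, hence lies in \<open>J\<close>; there left multiplication by \<open>x\<close> is onto, so also one-to-one.\<close>

lemma critical_lmult_inj:
  assumes crit: "critical J" and x: "x \<in> carrier R" and JM: "J \<subseteq> right_multiples x"
    and max: "maximal_right_ideal (right_multiples x) R"
    and a: "a \<in> carrier R" "x \<otimes> a = \<zero>"
  shows "a = \<zero>"
proof -
  have J: "right_ideal J R" using crit by (simp add: critical_def)
  from right_annihilator_power_stable[OF x]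
  obtain m :: nat where m: "\<forall>n\<ge>m. right_annihilator (x [^] n) = right_annihilator (x [^] m)" ..
  have xm: "x [^] m \<in> carrier R" using x by simp
  let ?N = "right_annihilator (x [^] m)"
  let ?P = "right_multiples (x [^] m)"
  have N: "right_ideal ?N R" by (rule right_ideal_right_annihilator[OF xm])
  have P: "right_ideal ?P R" by (rule right_ideal_right_multiples[OF xm])
  have "?N \<inter> ?P \<subseteq> {\<zero>}"
  proof
    fix b assume "b \<in> ?N \<inter> ?P"
    then obtain r where r: "r \<in> carrier R" "b = x [^] m \<otimes> r" "x [^] m \<otimes> b = \<zero>"
      by (auto simp: right_multiples_def right_annihilator_def)
    \<comment> \<open>Stability is used from exponent \<open>m\<close> to 2m, which is what makes
      \<open>?N\<close> and \<open>?P\<close> meet trivially.\<close>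
    then have "x [^] (m + m) \<otimes> r = \<zero>"
      using x by (metis m_assoc nat_pow_closed nat_pow_mult)
    then have "r \<in> ?N" using m[rule_format, of "m + m"] r(1) by (auto simp: right_annihilator_def)
    then show "b \<in> {\<zero>}" using r by (simp add: right_annihilator_def)
  qed
  then have art: "artinian_interval J (ideal_sum J ?N)"
    using artinian_interval_sum[OF J N P artinian_interval_power[OF x max]] by blast
  have NJ: "?N \<subseteq> J"
  proof (rule ccontr)
    assume "\<not> ?N \<subseteq> J"
    then have "J \<subset> ideal_sum J ?N" using ideal_sum_upper[OF J N] by blast
    then have "artinian_interval (ideal_sum J ?N) (carrier R)"
      using crit right_ideal_sum[OF J N] by (simp add: critical_def)
    then have "artinian_interval J (carrier R)"
      using artinian_interval_trans[OF art] right_ideal_sum[OF J N] right_ideal_carrier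
        ideal_sum_upper(1)[OF J N] right_idealD(1) by blast
    then show False using crit by (simp add: critical_def)
  qed
  have Suc: "b \<in> ?N \<longleftrightarrow> x [^] m \<otimes> (x \<otimes> b) = \<zero>" if "b \<in> carrier R" for b
  proof -
    have "b \<in> ?N \<longleftrightarrow> b \<in> right_annihilator (x [^] Suc m)"
      using m[rule_format, of "Suc m"] by (simp del: nat_pow_Suc)
    then show ?thesis
      using that x by (simp add: right_annihilator_def m_assoc)
  qed
  \<comment> \<open>Elements of \<open>?N\<close> lie in \<open>J\<close>, hence are of the form xc;
    then x^(m+1) c = 0, and stability returns \<open>c\<close> to \<open>?N\<close>.\<close>
  have "?N \<subseteq> (\<otimes>) x ` ?N"
  proof
    fix b assume b: "b \<in> ?N"
    then obtain c where c: "c \<in> carrier R" "b = x \<otimes> c"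
      using NJ JM by (auto simp: right_multiples_def)
    then have "c \<in> ?N" using b Suc by (simp add: right_annihilator_def)
    then show "b \<in> (\<otimes>) x ` ?N" using c by blast
  qed
  moreover have "a \<in> ?N" using Suc a x by simp
  ultimately show ?thesis using lmult_surj_imp_inj[OF x N] a by blast
qed

text \<open>Left multiplication by \<open>x\<close> is injective, so it identifies R with xR and the
  preimage with \<open>J\<close>. Essentiality is inherited; an artinian quotient by the preimage
  would, with the simple module R/xR, make R/J artinian; and a right ideal \<open>A\<close> above
  the preimage has xA strictly above \<open>J\<close>.\<close>

lemma critical_lmult_preimage:
  assumes crit: "critical J" and x: "x \<in> carrier R" and JM: "J \<subseteq> right_multiples x"
    and max: "maximal_right_ideal (right_multiples x) R"
  shows "critical (lmult_preimage x J)"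
proof -
  have J: "right_ideal J R" using crit by (simp add: critical_def)
  let ?J = "lmult_preimage x J"
  have xR: "right_ideal (right_multiples x) R" by (rule right_ideal_right_multiples[OF x])
  have zero: "a = \<zero>" if "a \<in> carrier R" "x \<otimes> a = \<zero>" for a
    using critical_lmult_inj[OF assms that] .
  have inj: "inj_on ((\<otimes>) x) (carrier R)"
  proof (rule inj_onI)
    fix a b assume ab: "a \<in> carrier R" "b \<in> carrier R" "x \<otimes> a = x \<otimes> b"
    then have "x \<otimes> (a \<ominus> b) = \<zero>" using x by (simp add: a_minus_def r_distr r_minus r_neg)
    then show "a = b" using zero[of "a \<ominus> b"] ab by simp
  qed
  have "essential ?J"
    unfolding essential_def
  proof (intro allI impI)
    fix U assume U: "right_ideal U R \<and> U \<inter> ?J \<subseteq> {\<zero>}"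
    then have UC: "U \<subseteq> carrier R" using right_idealD(1) by blast
    have "(\<otimes>) x ` U \<inter> J \<subseteq> {\<zero>}"
      using U UC x by (auto simp: lmult_preimage_def)
    then have "(\<otimes>) x ` U \<subseteq> {\<zero>}"
      using crit U right_ideal_image[of U, OF _ x] by (simp add: critical_def essential_def)
    then show "U \<subseteq> {\<zero>}" using zero UC by blast
  qed
  moreover have "\<not> artinian_interval ?J (carrier R)"
  proof
    assume "artinian_interval ?J (carrier R)"
    then have "artinian_interval J (carrier R)"
      by (rule artinian_interval_trans[OF artinian_interval_lmult[OF x] artinian_interval_maximal[OF max]
            xR right_ideal_carrier JM right_idealD(1)[OF xR]])
    then show False using crit by (simp add: critical_def)
  qed
  moreover have "artinian_interval A (carrier R)" if A: "right_ideal A R" "?J \<subset> A" for A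
  proof -
    have AC: "A \<subseteq> carrier R" by (rule right_idealD(1)[OF A(1)])
    have "(\<otimes>) x ` ?J \<subset> (\<otimes>) x ` A"
      by (rule image_strict_mono[OF inj_on_subset[OF inj AC] A(2)])
    then have "J \<subset> (\<otimes>) x ` A"
      by (simp add: image_preimage[OF JM])
    then have art: "artinian_interval ((\<otimes>) x ` A) (carrier R)"
      using crit right_ideal_image[OF A(1) x] by (simp add: critical_def)
    show ?thesis
    proof (rule artinian_interval_transfer[OF art, where \<phi> = "(`) ((\<otimes>) x)"])
      fix C D assume "C \<subseteq> D" "D \<subseteq> carrier R" "(\<otimes>) x ` C = (\<otimes>) x ` D"
      then show "C = D"
        using inj_on_image_eq_iff[OF inj, of C D] by simp
    next
      fix C assume "right_ideal C R" "A \<subseteq> C"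
      then show "right_ideal ((\<otimes>) x ` C) R \<and> (\<otimes>) x ` A \<subseteq> (\<otimes>) x ` C \<and> (\<otimes>) x ` C \<subseteq> carrier R"
        using right_ideal_image[OF _ x] right_idealD(1) image_mono by simp
    qed (rule image_mono)
  qed
  ultimately show ?thesis
    using right_ideal_lmult_preimage[OF J x] by (simp add: critical_def)
qed

end

section \<open>Noetherian rings whose maximal right ideals are principal\<close>

locale noetherian_principal_maximal = left_noetherian_ring + right_noetherian_ring +
  assumes maximal_principal: "maximal_right_ideal M R \<Longrightarrow> principal_right_ideal M R"
begin

lemma exists_maximal_right_multiples:
  assumes "right_ideal I R" "I \<noteq> carrier R"
  obtains x where "x \<in> carrier R" "I \<subseteq> right_multiples x" "maximal_right_ideal (right_multiples x) R"
proof -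
  obtain M where M: "maximal_right_ideal M R" "I \<subseteq> M"
    using exists_maximal_right_ideal[OF assms] .
  then obtain x where "x \<in> carrier R" "M = right_multiples x"
    using principal_right_ideal.generate[OF maximal_principal[OF M(1)]] by (auto simp: right_multiples_def)
  then show ?thesis using that M by blast
qed

lemma not_critical: "\<not> critical J"
proof
  assume critJ: "critical J"
  then obtain X where X: "finite X" "X \<subseteq> J" "\<And>B. \<lbrakk>right_ideal B R; X \<subseteq> B\<rbrakk> \<Longrightarrow> J \<subseteq> B"
    using right_ideal_finitely_generated[of J] critical_def by blast
  \<comment> \<open>From here on \<open>X\<close> serves as an index set: one critical ideal fixes
    the number of generators, while \<open>c\<close> ranges over all \<open>X\<close>-indexed
    families generating some critical ideal.\<close>
  define multiples where
    "multiples = (\<lambda>c :: 'a \<Rightarrow> 'a. {\<lambda>i. if i \<in> X then r \<otimes> c i else \<zero> | r. r \<in> carrier R})"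
  define generates where
    "generates = (\<lambda>(c :: 'a \<Rightarrow> 'a) J. c ` X \<subseteq> J \<and> (\<forall>B. right_ideal B R \<and> c ` X \<subseteq> B \<longrightarrow> J \<subseteq> B))"
  let ?S = "multiples ` {c. \<exists>J. critical J \<and> generates c J}"
  have "\<exists>M\<in>?S. \<forall>U\<in>?S. M \<subseteq> U \<longrightarrow> U = M"
  proof (rule left_submodule_maximal[OF X(1)])
    have "generates id J" using X by (simp add: generates_def)
    then show "?S \<noteq> {}" using critJ by blast
    fix U assume "U \<in> ?S"
    then obtain c J where c: "critical J" "generates c J" "U = multiples c" by blast
    then have "c i \<in> carrier R" if "i \<in> X" for i
      using that right_idealD(1) by (auto simp: generates_def critical_def)
    then show "left_submodule X U"
      unfolding c(3) multiples_def by (rule left_submodule_multiples)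
  qed
  from extremal_imageD[OF this] obtain c where "\<exists>K. critical K \<and> generates c K"
    and extremal: "\<forall>c'\<in>{c. \<exists>K. critical K \<and> generates c K}.
      multiples c \<subseteq> multiples c' \<longrightarrow> multiples c' = multiples c"
    by (elim bexE CollectE)
  then obtain K where K: "critical K" "generates c K" by (elim exE conjE)
  have max: "multiples c' = multiples c"
    if "critical K'" "generates c' K'" "multiples c \<subseteq> multiples c'" for c' K'
    using that by (intro extremal[rule_format] CollectI exI conjI)
  have KI: "right_ideal K R" using K(1) by (simp add: critical_def)
  have "K \<noteq> carrier R"
  proof
    assume "K = carrier R"
    moreover have "artinian_interval (carrier R) (carrier R)"
      unfolding artinian_interval_def by blast
    ultimately show False using K(1) by (simp add: critical_def)
  qed
  then obtain x where x: "x \<in> carrier R" "K \<subseteq> right_multiples x"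
    "maximal_right_ideal (right_multiples x) R"
    using exists_maximal_right_multiples[OF KI] by blast
  let ?L = "lmult_preimage x K"
  have critL: "critical ?L" by (rule critical_lmult_preimage[OF K(1) x])
  have LI: "right_ideal ?L R" using critL by (simp add: critical_def)
  have "\<forall>i\<in>X. \<exists>l\<in>?L. c i = x \<otimes> l"
  proof
    fix i assume "i \<in> X"
    then have "c i \<in> (\<otimes>) x ` ?L"
      using K(2) image_preimage[OF x(2)] by (auto simp: generates_def)
    then show "\<exists>l\<in>?L. c i = x \<otimes> l" by blast
  qed
  then obtain c' where c': "\<And>i. i \<in> X \<Longrightarrow> c' i \<in> ?L" "\<And>i. i \<in> X \<Longrightarrow> c i = x \<otimes> c' i"
    by metis
  have c'C: "c' i \<in> carrier R" if "i \<in> X" for i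
    using c'(1)[OF that] by (simp add: lmult_preimage_def)
  \<comment> \<open>If \<open>B\<close> contains the family \<open>c'\<close>, then xB contains
    \<open>c\<close> and hence \<open>K\<close>; cancelling \<open>x\<close> places
    \<open>?L\<close> inside \<open>B\<close>.\<close>
  have gen: "generates c' ?L"
    unfolding generates_def
  proof (intro conjI allI impI)
    show "c' ` X \<subseteq> ?L" using c'(1) by blast
    fix B assume B: "right_ideal B R \<and> c' ` X \<subseteq> B"
    then have "c ` X \<subseteq> (\<otimes>) x ` B" using c'(2) by blast
    then have sub: "K \<subseteq> (\<otimes>) x ` B"
      using K(2) B right_ideal_image[OF _ x(1)] by (simp add: generates_def)
    show "?L \<subseteq> B"
    proof
      fix l assume l: "l \<in> ?L"
      then obtain b where b: "b \<in> B" "x \<otimes> l = x \<otimes> b" using sub by (auto simp: lmult_preimage_def)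
      have carr: "l \<in> carrier R" "b \<in> carrier R"
        using l b B right_idealD(1) by (auto simp: lmult_preimage_def)
      have "x \<otimes> (l \<ominus> b) = \<zero>"
        using b(2) carr x(1) by (simp add: a_minus_def r_distr r_minus r_neg)
      then have "l \<ominus> b = \<zero>"
        using critical_lmult_inj[OF K(1) x] carr by simp
      then show "l \<in> B" using b carr by simp
    qed
  qed
  have "multiples c \<subseteq> multiples c'"
  proof
    fix f assume "f \<in> multiples c"
    then obtain r where r: "r \<in> carrier R" "f = (\<lambda>i. if i \<in> X then r \<otimes> c i else \<zero>)"
      by (auto simp: multiples_def)
    then have "f = (\<lambda>i. if i \<in> X then (r \<otimes> x) \<otimes> c' i else \<zero>)"
      using c'(2) c'C x(1) by (auto simp: m_assoc)
    then show "f \<in> multiples c'" unfolding multiples_def using r x(1) by blast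
  qed
  then have eq: "multiples c' = multiples c" using max[OF critL gen] by simp
  \<comment> \<open>The tuple \<open>c'\<close> itself, as its multiple by \<open>\<one>\<close>,
    must be a multiple of \<open>c\<close> since the two cyclic submodules agree.\<close>
  have "(\<lambda>i. if i \<in> X then \<one> \<otimes> c' i else \<zero>) \<in> multiples c'"
    unfolding multiples_def by blast
  then obtain r where r: "r \<in> carrier R"
    "(\<lambda>i. if i \<in> X then \<one> \<otimes> c' i else \<zero>) = (\<lambda>i. if i \<in> X then r \<otimes> c i else \<zero>)"
    unfolding eq by (auto simp: multiples_def)
  have rc: "c' i = r \<otimes> x \<otimes> c' i" if "i \<in> X" for i
    using fun_cong[OF r(2), of i] that c'C c'(2) r(1) x(1) by (simp add: m_assoc)
  define u where "u = \<one> \<ominus> r \<otimes> x"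
  have u: "u \<in> carrier R" using r x by (simp add: u_def)
  have "c' ` X \<subseteq> right_annihilator u"
  proof
    fix a assume "a \<in> c' ` X"
    then have a: "a \<in> carrier R" "a = r \<otimes> x \<otimes> a" using rc c'C by auto
    have "u \<otimes> a = a \<ominus> r \<otimes> x \<otimes> a"
      using a(1) r x by (simp add: u_def a_minus_def l_distr l_minus)
    then have "u \<otimes> a = \<zero>"
      using a by (simp add: a_minus_def r_neg)
    then show "a \<in> right_annihilator u" using a(1) by (simp add: right_annihilator_def)
  qed
  then have "?L \<subseteq> right_annihilator u"
    using gen right_ideal_right_annihilator[OF u] by (simp add: generates_def)
  then have "u \<otimes> l = \<zero>" if "l \<in> ?L" for l
    using that by (auto simp: right_annihilator_def)
  then obtain m :: nat where m: "u [^] m = \<zero>"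
    using nilpotent_if_annihilates_essential[OF u LI] critL by (auto simp: critical_def)
  \<comment> \<open>Every power of \<open>u\<close> is congruent to \<open>\<one>\<close> modulo Rx,
    so nilpotency of \<open>u\<close> provides a left inverse of \<open>x\<close>.\<close>
  have "\<exists>s\<in>carrier R. u [^] n = \<one> \<ominus> s \<otimes> x" for n :: nat
  proof (induction n)
    case 0
    show ?case using x(1) by (auto intro!: bexI[of _ \<zero>] simp: a_minus_def)
  next
    case (Suc n)
    then obtain s where s: "s \<in> carrier R" "u [^] n = \<one> \<ominus> s \<otimes> x" by blast
    have un: "u [^] n \<in> carrier R" using u by simp
    have "u [^] Suc n = u [^] n \<ominus> u [^] n \<otimes> r \<otimes> x"
      using un r x(1) by (simp add: u_def a_minus_def r_distr r_minus m_assoc)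
    also have "\<dots> = \<one> \<ominus> (s \<oplus> u [^] n \<otimes> r) \<otimes> x"
      using un s r x(1)
      by (subst s(2)) (simp add: a_minus_def l_distr a_assoc minus_add)
    finally show ?case using s r un by blast
  qed
  then obtain s where s: "s \<in> carrier R" "\<zero> = \<one> \<ominus> s \<otimes> x" using m by metis
  then have "s \<otimes> x = \<one>" using x(1) by (metis m_closed one_closed r_right_minus_eq)
  then have "x \<otimes> s = \<one>" using left_inverse_imp_right_inverse s x by blast
  then have "\<one> \<in> right_multiples x" using s(1) by (force simp: right_multiples_def)
  then have "right_multiples \<one> \<subseteq> right_multiples x"
    by (rule right_multiples_subset[OF right_ideal_right_multiples[OF x(1)]])
  then have "carrier R = right_multiples x"
    using right_idealD(1)[OF right_ideal_right_multiples[OF x(1)]] by (auto simp: right_multiples_one)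
  then show False using maximal_right_ideal.I_notcarr[OF x(3)] by blast
qed

lemma essential_imp_artinian:
  assumes "right_ideal J R" "essential J"
  shows "artinian_interval J (carrier R)"
proof (rule ccontr)
  let ?S = "{J. right_ideal J R \<and> essential J \<and> \<not> artinian_interval J (carrier R)}"
  assume "\<not> ?thesis"
  then have "?S \<noteq> {}" using assms by auto
  then obtain M where "M \<in> ?S" and max: "\<And>I. \<lbrakk>I \<in> ?S; M \<subseteq> I\<rbrakk> \<Longrightarrow> I = M"
    by (rule right_ideal_maximal_element[of ?S, OF _ _ that]) auto
  then have M: "right_ideal M R" "essential M" "\<not> artinian_interval M (carrier R)" by auto
  have "artinian_interval A (carrier R)" if A: "right_ideal A R" "M \<subset> A" for A
  proof -
    \<comment> \<open>Essentiality passes to larger right ideals, so a non-artinian quotient by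
      \<open>A\<close> would contradict the maximality of \<open>M\<close>.\<close>
    have "essential A" using M(2) A(2) unfolding essential_def by blast
    then show ?thesis using max A by blast
  qed
  then have "critical M" using M by (simp add: critical_def)
  then show False using not_critical by blast
qed

text \<open>The essential ideal I + C is principal, generated by some z = i + c. As the sum is
  direct, projecting to the first summand shows that \<open>i\<close> generates
  \<open>I\<close>.\<close>

lemma right_ideal_eq_right_multiples:
  assumes I: "right_ideal I R"
  shows "\<exists>i\<in>carrier R. I = right_multiples i"
proof -
  obtain C where C: "right_ideal C R" "I \<inter> C \<subseteq> {\<zero>}" "essential (ideal_sum I C)"
    using exists_essential_complement[OF I] .
  let ?J = "ideal_sum I C"
  have J: "right_ideal ?J R" by (rule right_ideal_sum[OF I C(1)])
  have "\<exists>z\<in>carrier R. ?J = right_multiples z"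
  proof (rule principal_if_artinian[OF _ J essential_imp_artinian[OF J C(3)]])
    fix I assume "right_ideal I R" "I \<noteq> carrier R"
    then show "\<exists>x\<in>carrier R. I \<subseteq> right_multiples x \<and> right_multiples x \<noteq> carrier R"
      using exists_maximal_right_multiples maximal_right_ideal.I_notcarr by metis
  qed
  then obtain z where z: "z \<in> carrier R" "?J = right_multiples z" by blast
  then obtain i c where ic: "i \<in> I" "c \<in> C" "z = i \<oplus> c"
    using right_multiples_self[OF z(1)] unfolding z(2)[symmetric] by (auto simp: ideal_sum_def)
  have carr: "i \<in> carrier R" "c \<in> carrier R"
    using ic right_idealD(1)[OF I] right_idealD(1)[OF C(1)] by auto
  have "I \<subseteq> right_multiples i"
  proof
    fix a assume a: "a \<in> I"
    then have "a \<in> right_multiples z" using ideal_sum_upper(1)[OF I C(1)] z by auto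
    then obtain r where r: "r \<in> carrier R" "a = (i \<oplus> c) \<otimes> r"
      using ic by (auto simp: right_multiples_def)
    have aC: "a \<in> carrier R" using a right_idealD(1)[OF I] by blast
    have eq: "a = i \<otimes> r \<oplus> c \<otimes> r" using r carr by (simp add: l_distr)
    \<comment> \<open>The left side lies in \<open>C\<close>, the right side in \<open>I\<close>;
      both are therefore zero.\<close>
    then have "c \<otimes> r = a \<ominus> i \<otimes> r"
      using add_minus_cancel_left r(1) carr by simp
    then have "c \<otimes> r \<in> I"
      using right_idealD(4)[OF I a right_idealD(5)[OF I ic(1) r(1)]] by simp
    then have "c \<otimes> r = \<zero>" using C(2) right_idealD(5)[OF C(1) ic(2) r(1)] by blast
    then have "a = i \<otimes> r" using eq carr r by simp
    then show "a \<in> right_multiples i" using r by (auto simp: right_multiples_def)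
  qed
  then show ?thesis
    using right_multiples_subset[OF I ic(1)] carr by blast
qed

end

theorem theorem7p9:
  fixes R (structure)
  assumes "ring R"
    and "left_noetherian_ring R"
    and "right_noetherian_ring R"
  shows "principal_right_ideal_ring R \<longleftrightarrow>
    (\<forall>M. maximal_right_ideal M R \<longrightarrow> principal_right_ideal M R)"
proof
  assume "principal_right_ideal_ring R"
  then show "\<forall>M. maximal_right_ideal M R \<longrightarrow> principal_right_ideal M R"
    using principal_right_ideal_ring.right_ideal_principal maximal_right_ideal.axioms(1) by blast
next
  assume max: "\<forall>M. maximal_right_ideal M R \<longrightarrow> principal_right_ideal M R"
  interpret noetherian_principal_maximal R
    using assms max
    by (intro noetherian_principal_maximal.intro noetherian_principal_maximal_axioms.intro) auto
  show "principal_right_ideal_ring R"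
  proof (intro principal_right_ideal_ring.intro principal_right_ideal_ring_axioms.intro)
    fix I assume I: "right_ideal I R"
    show "principal_right_ideal I R"
      using I right_ideal_eq_right_multiples[OF I]
      by (auto intro!: principal_right_ideal.intro principal_right_ideal_axioms.intro
          simp: right_multiples_def)
  qed (rule assms(1))
qed

end
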